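(* Let $0<p\le 1$, let $f(z)=\sum_{n=0}^{\infty}a_nz^n$ be an entire holomorphic function on $\mathbb{C}$, and let $S=\mathbb{N}\cup\{\infty\}$, regarded as a profinite set. Let $\mu_f$ be the (complex) measure on $S$ given by the assignment $n\mapsto \sqrt{a_n}$ for $n\in\mathbb{N}$ and $\infty\mapsto 0$ (mass $\sqrt{a_n}$ at the point $n$, mass $0$ at $\infty$). Then $\mu_f$ is an element of $\mathcal{M}_{<p}(S)$.
   Context: $\sqrt{a_n}$ denotes a chosen complex square root of $a_n$. The profinite set $S=\mathbb{N}\cup\{\infty\}$ is the one-point compactification of the discrete set $\mathbb{N}$; it is the limit $\varprojlim_i S_i$ of the finite sets $S_i=\{0,\dots,i,\infty\}$, where for $j>i$ the transition map $S_j\to S_i$ sends $x$ to $x$ if $0\le x\le i$ and to $\infty$ otherwise. For a finite set $T$, $q\in(0,1]$ and $c>0$, put $\mathbb{C}[T]_{\ell^q\le c}=\{(x_t)_{t\in T}\in\mathbb{C}[T] : \sum_{t}|x_t|^q\le c\}$. For a profinite set $T=\varprojlim_i T_i$ with $T_i$ finite, put $\mathcal{M}_q(T)=\bigcup_{c>0}\varprojlim_i \mathbb{C}[T_i]_{\ell^q\le c}$, where the transition maps are push-forward (summation over fibres), and $\mathcal{M}_{<p}(T)=\bigcup_{q<p}\mathcal{M}_q(T)$. A measure on $T$ is regarded as an element of the limit $\varprojlim_i \mathbb{C}[T_i]$ through its push-forwards to the $T_i$. *)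

theory Defs
  imports "HOL-Analysis.Analysis"
begin

section \<open>Inverse systems of finite sets\<close>

text \<open>The transition map \<open>r i j\<close> goes from \<open>T j\<close> to \<open>T i\<close>, for \<open>i \<le> j\<close>.\<close>

definition finite_inverse_system ::
    "('i::order \<Rightarrow> 't set) \<Rightarrow> ('i \<Rightarrow> 'i \<Rightarrow> 't \<Rightarrow> 't) \<Rightarrow> bool" where
  "finite_inverse_system T r \<longleftrightarrow>
     (\<forall>i j :: 'i. \<exists>k. i \<le> k \<and> j \<le> k) \<and>
     (\<forall>i. finite (T i)) \<and>
     (\<forall>i j. i \<le> j \<longrightarrow> r i j \<in> T j \<rightarrow> T i) \<and>
     (\<forall>i. \<forall>x\<in>T i. r i i x = x) \<and>
     (\<forall>i j k. i \<le> j \<longrightarrow> j \<le> k \<longrightarrow> (\<forall>x\<in>T k. r i j (r j k x) = r i k x))"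

definition inverse_limit ::
    "('i::order \<Rightarrow> 't set) \<Rightarrow> ('i \<Rightarrow> 'i \<Rightarrow> 't \<Rightarrow> 't) \<Rightarrow> ('i \<Rightarrow> 't) set" where
  "inverse_limit T r = {x. (\<forall>i. x i \<in> T i) \<and> (\<forall>i j. i \<le> j \<longrightarrow> r i j (x j) = x i)}"

definition inverse_limit_topology ::
    "('i::order \<Rightarrow> 't set) \<Rightarrow> ('i \<Rightarrow> 'i \<Rightarrow> 't \<Rightarrow> 't) \<Rightarrow> ('i \<Rightarrow> 't) topology" where
  "inverse_limit_topology T r =
     subtopology (product_topology (\<lambda>i. discrete_topology (T i)) UNIV) (inverse_limit T r)"

section \<open>The spaces of measures\<close>

text \<open>\<open>\<complex>[T]\<close> is represented by the complex functions that vanish outside \<open>T\<close>.\<close>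

definition free_space :: "'t set \<Rightarrow> ('t \<Rightarrow> complex) set" where
  "free_space T = {x. \<forall>t. t \<notin> T \<longrightarrow> x t = 0}"

definition lq_ball :: "'t set \<Rightarrow> real \<Rightarrow> real \<Rightarrow> ('t \<Rightarrow> complex) set" where
  "lq_ball T q c = {x \<in> free_space T. (\<Sum>t\<in>T. norm (x t) powr q) \<le> c}"

definition push_forward :: "('s \<Rightarrow> 't) \<Rightarrow> 's set \<Rightarrow> ('s \<Rightarrow> complex) \<Rightarrow> 't \<Rightarrow> complex" where
  "push_forward g A x = (\<lambda>t. \<Sum>s | s \<in> A \<and> g s = t. x s)"

definition lq_measures ::
    "('i::order \<Rightarrow> 't set) \<Rightarrow> ('i \<Rightarrow> 'i \<Rightarrow> 't \<Rightarrow> 't) \<Rightarrow> real \<Rightarrow> ('i \<Rightarrow> 't \<Rightarrow> complex) set" where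
  "lq_measures T r q =
     (\<Union>c\<in>{0<..}. {x. (\<forall>i. x i \<in> lq_ball (T i) q c) \<and>
        (\<forall>i j. i \<le> j \<longrightarrow> push_forward (r i j) (T j) (x j) = x i)})"

definition lt_measures ::
    "('i::order \<Rightarrow> 't set) \<Rightarrow> ('i \<Rightarrow> 'i \<Rightarrow> 't \<Rightarrow> 't) \<Rightarrow> real \<Rightarrow> ('i \<Rightarrow> 't \<Rightarrow> complex) set" where
  "lt_measures T r p = (\<Union>q\<in>{0<..<p}. lq_measures T r q)"

section \<open>Complex measures\<close>

text \<open>Since \<open>sums\<close> requires convergence to a complex number for every disjoint sequence, this
  is the usual notion of a (finite) complex measure; \<open>\<mu> {} = 0\<close> follows. Values of \<open>\<mu>\<close>
  outside \<open>sets M\<close> are irrelevant.\<close>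

definition complex_measure :: "'a measure \<Rightarrow> ('a set \<Rightarrow> complex) \<Rightarrow> bool" where
  "complex_measure M \<mu> \<longleftrightarrow>
     (\<forall>A :: nat \<Rightarrow> 'a set. range A \<subseteq> sets M \<longrightarrow> disjoint_family A \<longrightarrow>
        (\<lambda>n. \<mu> (A n)) sums \<mu> (\<Union>n. A n))"

text \<open>The set function with mass \<open>w x\<close> at each point \<open>x\<close>. If \<open>w\<close> is not summable,
  \<open>infsum\<close> takes a default value and this need not be a measure.\<close>

definition atomic_measure :: "('a \<Rightarrow> complex) \<Rightarrow> 'a set \<Rightarrow> complex" where
  "atomic_measure w A = (\<Sum>\<^sub>\<infinity>x\<in>A. w x)"

lemma atomic_measure_singleton: "atomic_measure w {x} = w x"
  by (simp add: atomic_measure_def)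

text \<open>The family of push-forwards of \<open>\<mu>\<close> along the projections \<open>pr i\<close> onto the \<open>T i\<close>.\<close>

definition measure_family ::
    "('i \<Rightarrow> 't set) \<Rightarrow> ('i \<Rightarrow> 'a \<Rightarrow> 't) \<Rightarrow> ('a set \<Rightarrow> complex) \<Rightarrow> 'i \<Rightarrow> 't \<Rightarrow> complex" where
  "measure_family T pr \<mu> = (\<lambda>i t. if t \<in> T i then \<mu> (pr i -` {t}) else 0)"

section \<open>The profinite set \<open>\<nat> \<union> {\<infinity>}\<close>\<close>

text \<open>\<open>S\<close> is the type \<^typ>\<open>enat\<close> with its order topology, in which every \<open>{enat n}\<close> is open
  and the neighbourhoods of \<open>\<infinity>\<close> are cofinite. The map \<open>S_trunc i\<close> serves both as
  the projection \<open>S \<rightarrow> S_level i\<close> and, for all \<open>j \<ge> i\<close>, as the transition map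
  \<open>S_level j \<rightarrow> S_level i\<close>.\<close>

definition S_level :: "nat \<Rightarrow> enat set" where
  "S_level i = insert \<infinity> (enat ` {0..i})"

definition S_trunc :: "nat \<Rightarrow> enat \<Rightarrow> enat" where
  "S_trunc i x = (if x \<le> enat i then x else \<infinity>)"

definition S_trans :: "nat \<Rightarrow> nat \<Rightarrow> enat \<Rightarrow> enat" where
  "S_trans i j = S_trunc i"

lemma S_trunc_mem: "S_trunc i x \<in> S_level i"
  by (cases x) (auto simp: S_trunc_def S_level_def)

lemma S_trunc_trunc: "i \<le> j \<Longrightarrow> S_trunc i (S_trunc j x) = S_trunc i x"
  by (cases x) (auto simp: S_trunc_def)

lemma finite_inverse_system_S: "finite_inverse_system S_level S_trans"
proof -
  have "\<exists>k. i \<le> k \<and> j \<le> k" for i j :: nat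
    by (rule exI[of _ "max i j"]) simp
  moreover have "finite (S_level i)" for i
    by (simp add: S_level_def)
  moreover have "S_trunc i x = x" if "x \<in> S_level i" for i x
    using that by (auto simp: S_level_def S_trunc_def)
  ultimately show ?thesis
    unfolding finite_inverse_system_def S_trans_def
    by (auto simp: S_trunc_mem S_trunc_trunc)
qed

lemma continuous_S_trunc:
  "continuous_map euclidean (discrete_topology (S_level i)) (S_trunc i)"
proof -
  have "open {x. S_trunc i x \<in> U}" for U
  proof (unfold open_enat_iff, intro impI)
    assume "\<infinity> \<in> {x. S_trunc i x \<in> U}"
    hence "\<infinity> \<in> U" by (simp add: S_trunc_def)
    hence "{enat i<..} \<subseteq> {x. S_trunc i x \<in> U}"
      by (auto simp: S_trunc_def)
    thus "\<exists>n. {enat n<..} \<subseteq> {x. S_trunc i x \<in> U}" by blast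
  qed
  thus ?thesis
    by (auto simp: continuous_map_def S_trunc_mem)
qed

lemma bij_betw_S_limit:
  "bij_betw (\<lambda>x i. S_trunc i x) UNIV (inverse_limit S_level S_trans)"
proof (rule bij_betw_imageI)
  show "inj (\<lambda>x i. S_trunc i x)"
  proof (rule injI)
    fix x y :: enat
    assume "(\<lambda>i. S_trunc i x) = (\<lambda>i. S_trunc i y)"
    hence eq: "S_trunc i x = S_trunc i y" for i by metis
    show "x = y"
    proof (cases x)
      case (enat n)
      with eq[of n] show ?thesis by (auto simp: S_trunc_def split: if_splits)
    next
      case infinity
      show ?thesis
      proof (cases y)
        case (enat n)
        with infinity eq[of n] show ?thesis by (auto simp: S_trunc_def)
      qed (use infinity in simp)
    qed
  qed
  show "range (\<lambda>x i. S_trunc i x) = inverse_limit S_level S_trans"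
  proof
    show "range (\<lambda>x i. S_trunc i x) \<subseteq> inverse_limit S_level S_trans"
      by (auto simp: inverse_limit_def S_trans_def S_trunc_mem S_trunc_trunc)
    show "inverse_limit S_level S_trans \<subseteq> range (\<lambda>x i. S_trunc i x)"
    proof
      fix y assume y: "y \<in> inverse_limit S_level S_trans"
      hence mem: "y i \<in> S_level i" for i by (simp add: inverse_limit_def)
      have comp: "S_trunc i (y j) = y i" if "i \<le> j" for i j
        using y that by (simp add: inverse_limit_def S_trans_def)
      show "y \<in> range (\<lambda>x i. S_trunc i x)"
      proof (cases "\<forall>i. y i = \<infinity>")
        case True
        hence "y = (\<lambda>i. S_trunc i \<infinity>)" by (auto simp: S_trunc_def)
        thus ?thesis by blast
      next
        case False
        then obtain k n where k: "y k = enat n" by (metis not_enat_eq)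
        have nk: "n \<le> k" using mem[of k] k by (auto simp: S_level_def)
        have "y i = S_trunc i (enat n)" for i
        proof (cases "i \<le> k")
          case True
          thus ?thesis using comp[of i k] k by simp
        next
          case False
          hence "S_trunc k (y i) = enat n" using comp[of k i] k by simp
          hence "y i = enat n" by (auto simp: S_trunc_def split: if_splits)
          thus ?thesis using nk False by (simp add: S_trunc_def)
        qed
        thus ?thesis by auto
      qed
    qed
  qed
qed

theorem S_homeomorphic_inverse_limit:
  "homeomorphic_map euclidean (inverse_limit_topology S_level S_trans) (\<lambda>x i. S_trunc i x)"
proof (rule continuous_imp_homeomorphic_map)
  have lim: "inverse_limit S_level S_trans \<subseteq> Pi\<^sub>E UNIV S_level"
    by (auto simp: inverse_limit_def)
  hence top: "topspace (inverse_limit_topology S_level S_trans) = inverse_limit S_level S_trans"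
    by (auto simp: inverse_limit_topology_def)
  show "compact_space (euclidean :: enat topology)"
    by (simp add: compact_space_def compactin_euclidean_iff compact_UNIV)
  show "Hausdorff_space (inverse_limit_topology S_level S_trans)"
    unfolding inverse_limit_topology_def
    by (intro Hausdorff_space_subtopology)
       (simp add: Hausdorff_space_product_topology)
  show "continuous_map euclidean (inverse_limit_topology S_level S_trans) (\<lambda>x i. S_trunc i x)"
    unfolding inverse_limit_topology_def continuous_map_in_subtopology
    using continuous_S_trunc bij_betw_S_limit
    by (auto simp: continuous_map_componentwise_UNIV bij_betw_def)
  show "(\<lambda>x i. S_trunc i x) ` topspace euclidean = topspace (inverse_limit_topology S_level S_trans)"
    using bij_betw_S_limit by (simp add: top bij_betw_def)
  show "inj_on (\<lambda>x i. S_trunc i x) (topspace euclidean)"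
    using bij_betw_S_limit by (simp add: bij_betw_def)
qed

text \<open>Mass \<open>b n\<close> at the point \<open>n\<close> and mass \<open>0\<close> at \<open>\<infinity>\<close>.\<close>

definition S_measure :: "(nat \<Rightarrow> complex) \<Rightarrow> enat set \<Rightarrow> complex" where
  "S_measure b = atomic_measure (\<lambda>x. case x of enat n \<Rightarrow> b n | \<infinity> \<Rightarrow> 0)"

end

theory Submission
  imports Defs
begin

text \<open>Every power \<open>norm (b n) powr q\<close> of the mass \<open>b n\<close> is dominated by a geometric series,
  because the coefficients of an entire function decay faster than any geometric sequence.
  Hence every \<open>q\<close> between \<open>0\<close> and \<open>p\<close> works. The push-forward to level \<open>i\<close> has the masses
  \<open>b 0, \<dots>, b i\<close> at the finite points, and its mass at \<open>\<infinity>\<close> is at most the total variation.\<close>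

text \<open>Disjointness makes \<open>snd\<close> injective on \<open>Sigma I A\<close>, so the sum
  over the union becomes a double sum whose inner sums can be taken first. Infinite \<open>I\<close>
  yields countable additivity, finite \<open>I\<close> the push-forward identity.\<close>

lemma infsum_UN_disjoint_has_sum:
  fixes w :: "'a \<Rightarrow> 'b :: banach"
  assumes "w summable_on UNIV" and "disjoint_family_on A I"
  shows "((\<lambda>i. infsum w (A i)) has_sum infsum w (\<Union>i\<in>I. A i)) I"
proof -
  have inj: "inj_on snd (Sigma I A)"
    using assms(2) by (fastforce simp: inj_on_def disjoint_family_on_def)
  have img: "snd ` Sigma I A = (\<Union>i\<in>I. A i)"
    by force
  have summ: "w summable_on B" for B
    by (rule summable_on_subset_banach[OF assms(1)]) simp
  have "(w has_sum infsum w (\<Union>i\<in>I. A i)) (snd ` Sigma I A)"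
    unfolding img by (rule has_sum_infsum[OF summ])
  hence "((\<lambda>(i, x). w x) has_sum infsum w (\<Union>i\<in>I. A i)) (Sigma I A)"
    by (simp add: has_sum_reindex[OF inj] o_def case_prod_unfold)
  thus ?thesis
    by (rule has_sum_SigmaD) (simp add: has_sum_infsum[OF summ])
qed

lemma complex_measure_atomic_measure:
  assumes "w summable_on UNIV"
  shows "complex_measure M (atomic_measure w)"
  unfolding complex_measure_def atomic_measure_def
  by (intro allI impI has_sum_imp_sums infsum_UN_disjoint_has_sum[OF assms])

lemma sum_atomic_measure_vimage:
  assumes "w summable_on UNIV" and "finite J"
  shows "(\<Sum>s\<in>J. atomic_measure w (h -` {s})) = atomic_measure w (h -` J)"
proof -
  have "disjoint_family_on (\<lambda>s. h -` {s}) J"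
    by (auto simp: disjoint_family_on_def)
  from infsum_UN_disjoint_has_sum[OF assms(1) this] assms(2) show ?thesis
    by (simp add: has_sum_finite_iff atomic_measure_def flip: vimage_eq_UN)
qed

text \<open>Compatibility comes from \<open>r\<close> composed with \<open>pr j\<close> being
  \<open>pr i\<close>: the fibre of \<open>pr i\<close> over \<open>t\<close> is the disjoint union
  of the fibres of \<open>pr j\<close> over the points that \<open>r\<close> sends to
  \<open>t\<close>.\<close>

lemma push_forward_measure_family:
  fixes T :: "'i::order \<Rightarrow> 't set"
  assumes "w summable_on UNIV" and "finite (T j)"
    and "\<And>x. pr j x \<in> T j" and "\<And>x. r (pr j x) = pr i x" and "\<And>x. pr i x \<in> T i"
  shows "push_forward r (T j) (measure_family T pr (atomic_measure w) j) =
         measure_family T pr (atomic_measure w) i"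
proof
  fix t
  have "push_forward r (T j) (measure_family T pr (atomic_measure w) j) t =
        (\<Sum>s | s \<in> T j \<and> r s = t. atomic_measure w (pr j -` {s}))"
    by (auto simp: push_forward_def measure_family_def intro!: sum.cong)
  also have "\<dots> = atomic_measure w (pr j -` {s \<in> T j. r s = t})"
    using assms(2) by (intro sum_atomic_measure_vimage[OF assms(1)]) simp
  also have "pr j -` {s \<in> T j. r s = t} = pr i -` {t}"
    using assms(3,4) by auto
  also have "atomic_measure w \<dots> = measure_family T pr (atomic_measure w) i t"
  \<comment> \<open>Off \<open>T i\<close> the family is 0 by definition; this agrees with the
    measure because the fibre is empty there.\<close>
  proof (cases "t \<in> T i")
    case False
    hence "pr i -` {t} = {}" using assms(5) by auto
    thus ?thesis using False by (simp add: measure_family_def atomic_measure_def)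
  qed (simp add: measure_family_def)
  finally show "push_forward r (T j) (measure_family T pr (atomic_measure w) j) t =
      measure_family T pr (atomic_measure w) i t" .
qed

lemma enat_case_abs_summable_on:
  fixes b :: "nat \<Rightarrow> complex"
  assumes "summable (\<lambda>n. norm (b n))"
  shows "(\<lambda>x. norm (case x of enat n \<Rightarrow> b n | \<infinity> \<Rightarrow> 0)) summable_on UNIV"
proof -
  have "(\<lambda>n. norm (b n)) summable_on UNIV"
    using assms by (simp add: summable_on_UNIV_nonneg_real_iff)
  hence "(\<lambda>x. norm (case x of enat n \<Rightarrow> b n | \<infinity> \<Rightarrow> 0)) summable_on range enat"
    by (subst summable_on_reindex) (auto simp: o_def inj_on_def)
  thus ?thesis
    \<comment> \<open>The only point outside \<open>range enat\<close> is \<infinity>, where the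
      function vanishes.\<close>
    by (rule summable_on_cong_neutral[THEN iffD1, rotated -1])
      (auto split: enat.splits)
qed

text \<open>The bound must be uniform in the level. \<open>sumq\<close> controls the finite points;
  the mass at \<infinity> on level \<open>i\<close> is the tail of \<open>b\<close> beyond
  \<open>i\<close>, which \<open>sum1\<close> controls.\<close>

lemma measure_family_S_measure_in_lq_measures:
  fixes b :: "nat \<Rightarrow> complex"
  assumes sum1: "summable (\<lambda>n. norm (b n))" and sumq: "summable (\<lambda>n. norm (b n) powr q)"
    and "0 < q"
  shows "measure_family S_level S_trunc (S_measure b) \<in> lq_measures S_level S_trans q"
proof -
  define w where "w = (\<lambda>x. case x of enat n \<Rightarrow> b n | \<infinity> \<Rightarrow> 0)"
  define x where "x = measure_family S_level S_trunc (atomic_measure w)"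
  define D where "D = (\<Sum>\<^sub>\<infinity>y. norm (w y))"
  \<comment> \<open>The first two terms bound the contributions of \<infinity> and of the finite
    points; the added 1 keeps \<open>c\<close> positive even when \<open>b\<close> is zero.\<close>
  define c where "c = D powr q + (\<Sum>n. norm (b n) powr q) + 1"
  have abs: "(\<lambda>y. norm (w y)) summable_on UNIV"
    unfolding w_def by (rule enat_case_abs_summable_on[OF sum1])
  hence summ: "w summable_on UNIV" by (rule abs_summable_summable)
  have "0 \<le> (\<Sum>n. norm (b n) powr q)"
    by (intro suminf_nonneg sumq) simp
  hence c: "c > 0" by (simp add: c_def add_nonneg_pos)
  have bound: "norm (atomic_measure w A) \<le> D" for A
  proof -
    have A: "(\<lambda>y. norm (w y)) summable_on A"
      by (rule summable_on_subset_banach[OF abs]) simp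
    have "norm (atomic_measure w A) \<le> (\<Sum>\<^sub>\<infinity>y\<in>A. norm (w y))"
      unfolding atomic_measure_def by (rule norm_infsum_bound[OF A])
    also have "\<dots> \<le> D"
      unfolding D_def by (rule infsum_mono_neutral[OF A abs]) auto
    finally show ?thesis .
  qed
  have "x i \<in> lq_ball (S_level i) q c" for i
  proof -
    have "S_trunc i -` {enat n} = {enat n}" if "n \<le> i" for n
      using that by (auto simp: S_trunc_def split: if_splits)
    hence fin: "x i (enat n) = b n" if "n \<le> i" for n
      using that by (simp add: x_def measure_family_def S_level_def atomic_measure_singleton w_def)
    have "(\<Sum>t\<in>S_level i. norm (x i t) powr q) =
          norm (x i \<infinity>) powr q + (\<Sum>n\<in>{0..i}. norm (x i (enat n)) powr q)"
      unfolding S_level_def by (subst sum.insert) (auto simp: sum.reindex inj_on_def)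
    also have "(\<Sum>n\<in>{0..i}. norm (x i (enat n)) powr q) = (\<Sum>n\<in>{0..i}. norm (b n) powr q)"
      by (intro sum.cong) (auto simp: fin)
    also have "\<dots> \<le> (\<Sum>n. norm (b n) powr q)"
      by (intro sum_le_suminf sumq) auto
    also have "norm (x i \<infinity>) powr q \<le> D powr q"
      using bound \<open>0 < q\<close>
      by (intro powr_mono2) (auto simp: x_def measure_family_def S_level_def)
    finally show ?thesis
      by (auto simp: lq_ball_def free_space_def c_def x_def measure_family_def)
  qed
  moreover have "push_forward (S_trans i j) (S_level j) (x j) = x i" if "i \<le> j" for i j
    unfolding x_def S_trans_def
    by (intro push_forward_measure_family summ)
      (simp_all add: S_trunc_mem S_trunc_trunc that, simp add: S_level_def)
  ultimately have "x \<in> lq_measures S_level S_trans q"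
    unfolding lq_measures_def using c by blast
  thus ?thesis by (simp add: x_def w_def S_measure_def)
qed

text \<open>Convergence at one point outside the unit circle suffices. The value 4 is a convenient
  square: boundedness of \<open>a n * 4 ^ n\<close> passes through the square root to geometric
  decay of \<open>b n\<close> with ratio 1/2, and the power \<open>q\<close> turns this ratio into
  \<open>2 powr - q\<close>, which is below 1.\<close>

lemma sqrt_coeff_powr_summable:
  fixes a b :: "nat \<Rightarrow> complex"
  assumes "summable (\<lambda>n. a n * 4 ^ n)" and b: "\<And>n. (b n)\<^sup>2 = a n" and "0 < q"
  shows "summable (\<lambda>n. norm (b n) powr q)"
proof -
  have "Bseq (\<lambda>n. a n * 4 ^ n)"
    by (rule convergent_imp_Bseq[OF convergentI[OF summable_LIMSEQ_zero[OF assms(1)]]])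
  then obtain K where K: "K > 0" "\<And>n. norm (a n * 4 ^ n) \<le> K"
    by (auto elim: BseqE)
  have "norm (b n) \<le> sqrt K / 2 ^ n" for n
  proof -
    have "(2 ^ n :: real)\<^sup>2 = 4 ^ n"
      by (simp add: power2_eq_square flip: power_mult_distrib)
    hence "(norm (b n) * 2 ^ n)\<^sup>2 = norm (a n * 4 ^ n)"
      by (simp add: norm_mult norm_power power_mult_distrib flip: b)
    hence "norm (b n) * 2 ^ n \<le> sqrt K"
      using K(2)[of n] by (intro real_le_rsqrt) simp
    thus ?thesis by (simp add: field_simps)
  qed
  hence "norm (b n) powr q \<le> (sqrt K / 2 ^ n) powr q" for n
    using \<open>0 < q\<close> by (intro powr_mono2) auto
  also have "(sqrt K / 2 ^ n) powr q = sqrt K powr q * (2 powr - q) ^ n" for n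
  proof -
    have "(2 ^ n) powr q = ((2::real) powr q) ^ n"
      by (simp add: powr_powr mult.commute flip: powr_realpow)
    thus ?thesis
      using K(1) by (simp add: powr_divide powr_minus_divide power_divide)
  qed
  finally have le: "norm (b n) powr q \<le> sqrt K powr q * (2 powr - q) ^ n" for n .
  have "(2::real) powr - q < 1"
    using \<open>0 < q\<close> by (intro powr_less_one) auto
  hence "summable (\<lambda>n. sqrt K powr q * (2 powr - q) ^ n)"
    by (intro summable_mult summable_geometric) simp
  thus ?thesis
    by (rule summable_comparison_test') (simp add: le)
qed

theorem proposition5p4:
  fixes p :: real and f :: "complex \<Rightarrow> complex" and a sqrt_a :: "nat \<Rightarrow> complex"
  assumes "0 < p" and "p \<le> 1"
    and "f holomorphic_on UNIV"
    and "\<And>z. (\<lambda>n. a n * z ^ n) sums f z"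
    and "\<And>n. (sqrt_a n)\<^sup>2 = a n"
  shows "complex_measure borel (S_measure sqrt_a) \<and>
         measure_family S_level S_trunc (S_measure sqrt_a) \<in> lt_measures S_level S_trans p"
proof
  have summq: "summable (\<lambda>n. norm (sqrt_a n) powr q)" if "0 < q" for q
    \<comment> \<open>Unification evaluates the power series at \<open>z = 4\<close>.\<close>
    using sqrt_coeff_powr_summable[OF sums_summable[OF assms(4)] assms(5) that] .
  \<comment> \<open>The exponent 1 is available whatever \<open>p\<close> is, since
    \<open>summq\<close> holds for all positive exponents; it gives the absolute summability behind
    the complex measure.\<close>
  have summ1: "summable (\<lambda>n. norm (sqrt_a n))"
    using summq[of 1] by simp
  show "complex_measure borel (S_measure sqrt_a)"
    unfolding S_measure_def
    by (rule complex_measure_atomic_measure[OF abs_summable_summable[OF enat_case_abs_summable_on[OF summ1]]])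
  have "measure_family S_level S_trunc (S_measure sqrt_a) \<in> lq_measures S_level S_trans (p / 2)"
    using assms(1) by (intro measure_family_S_measure_in_lq_measures summ1 summq) auto
  thus "measure_family S_level S_trunc (S_measure sqrt_a) \<in> lt_measures S_level S_trans p"
    unfolding lt_measures_def using assms(1) by (intro UN_I[of "p / 2"]) auto
qed

end
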